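(* There exists a stochastic finite-state generator (SG) such that the process language it generates is not recognized by any (finite-state) stochastic deterministic finite-state recognizer (SDR).
   Context: A stochastic language over a finite alphabet $\Sigma$ is given by a word distribution $\Pr:\Sigma^*\to[0,1]$ with $\sum_{w\in\Sigma^L}\Pr(w)=1$ for all $L\ge1$. It is a process language if it is subword closed (every contiguous subword of a word of positive probability has positive probability) and $\Pr(w)\ge\Pr(w\sigma)$ for all words $w$ and symbols $\sigma$. A stochastic finite-state generator (SG) consists of a finite state set $S$ with a start state $s_0$, a finite output alphabet $Y$, and nonnegative $|S|\times|S|$ matrices $T(y)$, $y\in Y$, such that $\sum_{y\in Y}T(y)$ is (row-)stochastic; $T_{ij}(y)$ is the probability, when in state $i$, of going to state $j$ and emitting $y$. It generates the word distribution $\Pr(y_0\cdots y_{L-1})=\langle\pi^0|T(y_0)\cdots T(y_{L-1})|\eta\rangle$, where $\langle\pi^0|=(1,0,\dots,0)$ is concentrated on $s_0$ and $|\eta\rangle$ is the all-ones column vector. A stochastic finite-state recognizer (SR) is defined by the same kind of data, with matrices $T(x)$ indexed by the symbols $x$ of a finite input alphabet $X$ and with $\sum_{x\in X}T(x)$ stochastic; it accepts the word $x_0\cdots x_{L-1}$ with probability $\langle\pi^0|T(x_0)\cdots T(x_{L-1})|\eta\rangle$. An SDR is an SR in which each $T(x)$ has at most one nonzero element per row. The SR recognizes a process language if its acceptance probability of every word equals that word's probability in the language. *)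

theory Defs
  imports "Jordan_Normal_Form.Matrix" "HOL-Library.Sublist"
begin

definition stochastic_language :: "'a set \<Rightarrow> ('a list \<Rightarrow> real) \<Rightarrow> bool" where
  "stochastic_language \<Sigma> Pr \<longleftrightarrow>
     finite \<Sigma> \<and>
     (\<forall>w \<in> lists \<Sigma>. 0 \<le> Pr w \<and> Pr w \<le> 1) \<and>
     (\<forall>L\<ge>1. (\<Sum>w | w \<in> lists \<Sigma> \<and> length w = L. Pr w) = 1)"

text \<open>The library relation \<^const>\<open>sublist\<close> is the contiguous-subword relation.\<close>

definition process_language :: "'a set \<Rightarrow> ('a list \<Rightarrow> real) \<Rightarrow> bool" where
  "process_language \<Sigma> Pr \<longleftrightarrow>
     stochastic_language \<Sigma> Pr \<and>
     (\<forall>w \<in> lists \<Sigma>. \<forall>v. Pr w > 0 \<longrightarrow> sublist v w \<longrightarrow> Pr v > 0) \<and>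
     (\<forall>w \<in> lists \<Sigma>. \<forall>a \<in> \<Sigma>. Pr w \<ge> Pr (w @ [a]))"

text \<open>The data shared by generators and recognizers. The states of a machine with \<open>n\<close> states
  are \<open>0, \<dots>, n - 1\<close> and the start state is \<open>0\<close>; the values of \<open>trans\<close> outside the alphabet
  are irrelevant.\<close>

record 'a machine =
  num_states :: nat
  alphabet :: "'a set"
  trans :: "'a \<Rightarrow> real mat"

definition row_stochastic :: "real mat \<Rightarrow> bool" where
  "row_stochastic A \<longleftrightarrow>
     (\<forall>i < dim_row A. \<forall>j < dim_col A. 0 \<le> A $$ (i, j)) \<and>
     (\<forall>i < dim_row A. (\<Sum>j < dim_col A. A $$ (i, j)) = 1)"

definition total_mat :: "'a machine \<Rightarrow> real mat" where
  "total_mat M = mat (num_states M) (num_states M)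
     (\<lambda>(i, j). \<Sum>y \<in> alphabet M. trans M y $$ (i, j))"

definition stochastic_machine :: "'a machine \<Rightarrow> bool" where
  "stochastic_machine M \<longleftrightarrow>
     num_states M > 0 \<and>
     finite (alphabet M) \<and>
     (\<forall>y \<in> alphabet M. trans M y \<in> carrier_mat (num_states M) (num_states M) \<and>
        (\<forall>i < num_states M. \<forall>j < num_states M. 0 \<le> trans M y $$ (i, j))) \<and>
     row_stochastic (total_mat M)"

definition word_mat :: "'a machine \<Rightarrow> 'a list \<Rightarrow> real mat" where
  "word_mat M w = foldr (\<lambda>y A. trans M y * A) w (1\<^sub>m (num_states M))"

text \<open>The generation probability of a word for a generator, and its acceptance probability
  for a recognizer.\<close>

definition word_prob :: "'a machine \<Rightarrow> 'a list \<Rightarrow> real" where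
  "word_prob M w =
     unit_vec (num_states M) 0 \<bullet> (word_mat M w *\<^sub>v vec (num_states M) (\<lambda>_. 1))"

definition SG :: "'a machine \<Rightarrow> bool" where
  "SG G \<longleftrightarrow> stochastic_machine G"

definition SR :: "'a machine \<Rightarrow> bool" where
  "SR R \<longleftrightarrow> stochastic_machine R"

definition SDR :: "'a machine \<Rightarrow> bool" where
  "SDR R \<longleftrightarrow> SR R \<and>
     (\<forall>x \<in> alphabet R. \<forall>i < num_states R.
        card {j. j < num_states R \<and> trans R x $$ (i, j) \<noteq> 0} \<le> 1)"

definition recognizes :: "'a machine \<Rightarrow> 'a set \<Rightarrow> ('a list \<Rightarrow> real) \<Rightarrow> bool" where
  "recognizes R \<Sigma> Pr \<longleftrightarrow>
     alphabet R = \<Sigma> \<and> (\<forall>w \<in> lists \<Sigma>. word_prob R w = Pr w)"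

end

theory Submission
  imports Defs
begin

text \<open>In a deterministic recognizer the word \<open>a\<^sup>m\<close> follows a single path, which revisits a state
  by the pigeonhole principle, so the probabilities \<open>f m\<close> of \<open>a\<^sup>m\<close> contain a three-term geometric
  progression \<open>f k\<close>, \<open>f (k + p)\<close>, \<open>f (k + 2 p)\<close> with \<open>p > 0\<close>. A generator in which \<open>a\<close> acts by
  a Jordan block has \<open>f m\<close> equal to a nonconstant affine function of \<open>m\<close> times \<open>2\<^sup>-\<^sup>m\<close>, which
  contains no such progression.\<close>

section \<open>Word probabilities as functions of the start state\<close>

definition state_prob :: "'a machine \<Rightarrow> 'a list \<Rightarrow> nat \<Rightarrow> real" where
  "state_prob M w i = (word_mat M w *\<^sub>v vec (num_states M) (\<lambda>_. 1)) $ i"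

lemma word_mat_carrier:
  assumes "stochastic_machine M" "w \<in> lists (alphabet M)"
  shows "word_mat M w \<in> carrier_mat (num_states M) (num_states M)"
  using assms(2)
proof (induction w)
  case Nil
  then show ?case by (simp add: word_mat_def)
next
  case (Cons y w)
  then have "trans M y \<in> carrier_mat (num_states M) (num_states M)"
    using assms(1) by (simp add: stochastic_machine_def)
  moreover have "word_mat M (y # w) = trans M y * word_mat M w"
    by (simp add: word_mat_def)
  ultimately show ?case using Cons by auto
qed

lemma state_prob_Nil: "i < num_states M \<Longrightarrow> state_prob M [] i = 1"
  by (simp add: state_prob_def word_mat_def)

text \<open>First-step recursion, from associativity of the matrix action. The first symbol moves
  the machine away from its start state, so inductions over words need the start state to
  vary.\<close>

lemma state_prob_Cons:
  assumes M: "stochastic_machine M" and w: "w \<in> lists (alphabet M)" and y: "y \<in> alphabet M"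
    and i: "i < num_states M"
  shows "state_prob M (y # w) i =
    (\<Sum>j<num_states M. trans M y $$ (i, j) * state_prob M w j)"
proof -
  let ?n = "num_states M" and ?e = "vec (num_states M) (\<lambda>_. 1) :: real vec"
  have T: "trans M y \<in> carrier_mat ?n ?n"
    using M y by (simp add: stochastic_machine_def)
  have W: "word_mat M w \<in> carrier_mat ?n ?n"
    using word_mat_carrier[OF M w] .
  have "word_mat M (y # w) *\<^sub>v ?e = trans M y *\<^sub>v (word_mat M w *\<^sub>v ?e)"
    using assoc_mult_mat_vec[OF T W] by (simp add: word_mat_def)
  then show ?thesis
    using T W i by (simp add: state_prob_def scalar_prod_def lessThan_atLeast0)
qed

lemma word_prob_eq_state_prob:
  assumes M: "stochastic_machine M" and w: "w \<in> lists (alphabet M)"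
  shows "word_prob M w = state_prob M w 0"
proof -
  have "0 < num_states M" using M by (simp add: stochastic_machine_def)
  moreover have "word_mat M w *\<^sub>v vec (num_states M) (\<lambda>_. 1) \<in> carrier_vec (num_states M)"
    using word_mat_carrier[OF M w] by auto
  ultimately show ?thesis
    by (simp add: word_prob_def state_prob_def)
qed

section \<open>Stochastic machines and the axioms of a process language\<close>

lemma trans_nonneg:
  assumes "stochastic_machine M" "y \<in> alphabet M" "i < num_states M" "j < num_states M"
  shows "0 \<le> trans M y $$ (i, j)"
  using assms by (simp add: stochastic_machine_def)

lemma sum_trans:
  assumes "stochastic_machine M" "i < num_states M"
  shows "(\<Sum>y\<in>alphabet M. \<Sum>j<num_states M. trans M y $$ (i, j)) = 1"
proof -
  have "(\<Sum>j<num_states M. \<Sum>y\<in>alphabet M. trans M y $$ (i, j)) = 1"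
    using assms by (simp add: stochastic_machine_def row_stochastic_def total_mat_def)
  then show ?thesis by (subst sum.swap)
qed

lemma state_prob_nonneg:
  assumes M: "stochastic_machine M"
  shows "w \<in> lists (alphabet M) \<Longrightarrow> i < num_states M \<Longrightarrow> 0 \<le> state_prob M w i"
proof (induction w arbitrary: i)
  case Nil
  then show ?case by (simp add: state_prob_Nil)
next
  case (Cons y w)
  then show ?case
    by (auto simp: state_prob_Cons[OF M] intro!: sum_nonneg mult_nonneg_nonneg trans_nonneg[OF M])
qed

text \<open>The new symbol is last while the recursion works on the first, so the inequality reduces
  to the empty word. There it says that a row sum of one \<open>trans M a\<close> is at most the row
  sum 1 of all symbols together. Nonnegative weights carry it back through \<open>w\<close>.\<close>

lemma state_prob_append_le:
  assumes M: "stochastic_machine M" and a: "a \<in> alphabet M"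
  shows "w \<in> lists (alphabet M) \<Longrightarrow> i < num_states M \<Longrightarrow>
    state_prob M (w @ [a]) i \<le> state_prob M w i"
proof (induction w arbitrary: i)
  case Nil
  have "(\<Sum>j<num_states M. trans M a $$ (i, j)) \<le>
      (\<Sum>y\<in>alphabet M. \<Sum>j<num_states M. trans M y $$ (i, j))"
    using M Nil by (intro member_le_sum[OF a] sum_nonneg)
      (auto simp: stochastic_machine_def)
  then show ?case
    using sum_trans[OF M] Nil by (simp add: state_prob_Cons[OF M _ a] state_prob_Nil)
next
  case (Cons y w)
  then show ?case
    using a by (auto simp: state_prob_Cons[OF M] intro!: sum_mono mult_left_mono trans_nonneg[OF M])
qed

lemma sum_lists_Suc:
  fixes f :: "'a list \<Rightarrow> real"
  shows "(\<Sum>w | w \<in> lists A \<and> length w = Suc L. f w) =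
    (\<Sum>y\<in>A. \<Sum>w | w \<in> lists A \<and> length w = L. f (y # w))"
proof -
  let ?W = "{w. w \<in> lists A \<and> length w = L}"
  have eq: "{w. w \<in> lists A \<and> length w = Suc L} = (\<lambda>(y, w). y # w) ` (A \<times> ?W)"
    by (auto simp: length_Suc_conv image_iff)
  have "inj_on (\<lambda>(y, w). y # w) (A \<times> ?W)"
    by (auto simp: inj_on_def)
  then show ?thesis
    unfolding eq by (simp add: sum.reindex sum.cartesian_product case_prod_unfold)
qed

text \<open>Once the first symbol is split off, the shorter words have total mass 1 from every state
  \<open>j\<close> by induction. What remains is a row sum of the total matrix.\<close>

lemma sum_state_prob:
  assumes M: "stochastic_machine M"
  shows "i < num_states M \<Longrightarrow>
    (\<Sum>w | w \<in> lists (alphabet M) \<and> length w = L. state_prob M w i) = 1"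
proof (induction L arbitrary: i)
  case 0
  have "{w. w \<in> lists (alphabet M) \<and> length w = 0} = {[]}" by auto
  then show ?case using 0 by (simp add: state_prob_Nil)
next
  case (Suc L)
  let ?W = "{w. w \<in> lists (alphabet M) \<and> length w = L}"
  have "(\<Sum>w | w \<in> lists (alphabet M) \<and> length w = Suc L. state_prob M w i) =
      (\<Sum>y\<in>alphabet M. \<Sum>w\<in>?W. \<Sum>j<num_states M. trans M y $$ (i, j) * state_prob M w j)"
    unfolding sum_lists_Suc using Suc.prems
    by (intro sum.cong refl) (auto simp: state_prob_Cons[OF M])
  also have "\<dots> = (\<Sum>y\<in>alphabet M. \<Sum>j<num_states M. trans M y $$ (i, j) * (\<Sum>w\<in>?W. state_prob M w j))"
    by (intro sum.cong refl) (subst sum.swap, simp add: sum_distrib_left)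
  also have "\<dots> = (\<Sum>y\<in>alphabet M. \<Sum>j<num_states M. trans M y $$ (i, j))"
    by (intro sum.cong refl) (simp add: Suc.IH)
  finally show ?case using sum_trans[OF M Suc.prems] by simp
qed

lemma stochastic_language_word_prob:
  assumes M: "stochastic_machine M"
  shows "stochastic_language (alphabet M) (word_prob M)"
proof -
  have n: "0 < num_states M" using M by (simp add: stochastic_machine_def)
  \<comment> \<open>Removing last symbols one by one never lowers the value, and the empty word has
    value 1.\<close>
  have le: "state_prob M w 0 \<le> 1" if "w \<in> lists (alphabet M)" for w
    using that
  proof (induction w rule: rev_induct)
    case Nil
    then show ?case using n by (simp add: state_prob_Nil)
  next
    case (snoc a w)
    then show ?case using state_prob_append_le[OF M, of a w 0] n by auto
  qed
  have "(\<Sum>w | w \<in> lists (alphabet M) \<and> length w = L. word_prob M w) = 1" for L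
    using sum_state_prob[OF M n, of L]
    by (simp add: word_prob_eq_state_prob[OF M] cong: sum.cong_simp)
  then show ?thesis
    using M n le state_prob_nonneg[OF M]
    by (auto simp: stochastic_language_def word_prob_eq_state_prob[OF M] stochastic_machine_def)
qed

text \<open>If all words over the alphabet are positive, subword closure only needs that subwords
  stay over the alphabet.\<close>

lemma process_language_word_prob:
  assumes M: "stochastic_machine M" and pos: "\<And>w. w \<in> lists (alphabet M) \<Longrightarrow> 0 < word_prob M w"
  shows "process_language (alphabet M) (word_prob M)"
proof -
  have n: "0 < num_states M" using M by (simp add: stochastic_machine_def)
  have "v \<in> lists (alphabet M)" if "w \<in> lists (alphabet M)" "sublist v w" for v w
    using that by (auto simp: sublist_def)
  moreover have "word_prob M (w @ [a]) \<le> word_prob M w"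
    if "w \<in> lists (alphabet M)" "a \<in> alphabet M" for w a
    using state_prob_append_le[OF M that(2,1) n] that by (simp add: word_prob_eq_state_prob[OF M])
  ultimately show ?thesis
    using stochastic_language_word_prob[OF M] pos by (auto simp: process_language_def)
qed

section \<open>Deterministic recognizers reading powers of one letter\<close>

lemma SDR_successor:
  assumes R: "SDR R" and a: "a \<in> alphabet R"
  obtains \<delta> where "\<And>i. i < num_states R \<Longrightarrow> \<delta> i < num_states R"
    and "\<And>i j. i < num_states R \<Longrightarrow> j < num_states R \<Longrightarrow> j \<noteq> \<delta> i \<Longrightarrow> trans R a $$ (i, j) = 0"
proof -
  have "\<exists>d<num_states R. \<forall>j<num_states R. j \<noteq> d \<longrightarrow> trans R a $$ (i, j) = 0"
    if i: "i < num_states R" for i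
  proof -
    let ?S = "{j. j < num_states R \<and> trans R a $$ (i, j) \<noteq> 0}"
    have "card ?S \<le> 1" using R a i by (simp add: SDR_def)
    then have eq: "j = k" if "j \<in> ?S" "k \<in> ?S" for j k
      using that card_le_Suc0_iff_eq[of ?S] by auto
    show ?thesis
    proof (cases "?S = {}")
      case True
      \<comment> \<open>In an all-zero row any state may serve as successor; \<open>i\<close>
        witnesses that one exists. This keeps \<open>\<delta>\<close> total.\<close>
      then show ?thesis using i by auto
    next
      case False
      then obtain d where "d \<in> ?S" by auto
      then show ?thesis using eq by blast
    qed
  qed
  then obtain \<delta> where "\<forall>i<num_states R. \<delta> i < num_states R \<and>
      (\<forall>j<num_states R. j \<noteq> \<delta> i \<longrightarrow> trans R a $$ (i, j) = 0)"
    by metis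
  then show ?thesis using that by blast
qed

text \<open>Each traversal of the loop of length \<open>p\<close> multiplies the probability by the
  same factor. The product form of the conclusion also covers vanishing probabilities, with no
  division.\<close>

lemma SDR_geometric_progression:
  assumes R: "SDR R" and a: "a \<in> alphabet R"
  obtains k p where "0 < p"
    and "word_prob R (replicate k a) * word_prob R (replicate (k + 2 * p) a) =
      (word_prob R (replicate (k + p) a))\<^sup>2"
proof -
  let ?n = "num_states R"
  have M: "stochastic_machine R" using R by (simp add: SDR_def SR_def)
  then have n: "0 < ?n" by (simp add: stochastic_machine_def)
  obtain \<delta> where \<delta>: "\<And>i. i < ?n \<Longrightarrow> \<delta> i < ?n"
    and zero: "\<And>i j. i < ?n \<Longrightarrow> j < ?n \<Longrightarrow> j \<noteq> \<delta> i \<Longrightarrow> trans R a $$ (i, j) = 0"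
    using SDR_successor[OF R a] by blast
  define u where "u m i = state_prob R (replicate m a) i" for m i
  have lists: "replicate m a \<in> lists (alphabet R)" for m using a by auto
  have u0: "u 0 i = 1" if "i < ?n" for i using that by (simp add: u_def state_prob_Nil)
  have uSuc: "u (Suc m) i = trans R a $$ (i, \<delta> i) * u m (\<delta> i)" if i: "i < ?n" for m i
  proof -
    have "u (Suc m) i = (\<Sum>j<?n. trans R a $$ (i, j) * u m j)"
      using state_prob_Cons[OF M lists a i] by (simp add: u_def)
    also have "\<dots> = (\<Sum>j\<in>{\<delta> i}. trans R a $$ (i, j) * u m j)"
      by (rule sum.mono_neutral_right) (use zero \<delta> i in auto)
    finally show ?thesis by simp
  qed
  \<comment> \<open>Along the single path the weights multiply: \<open>k\<close> letters from
    \<open>i\<close>, then \<open>m\<close> letters from the state reached.\<close>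
  have uadd: "u (k + m) i = u k i * u m ((\<delta> ^^ k) i)" if "i < ?n" for k m i
    using that by (induction k arbitrary: i)
      (simp_all add: u0 uSuc \<delta> funpow_swap1 del: funpow.simps(2) add: funpow_Suc_right)
  \<comment> \<open>Times \<open>0\<close> to \<open>?n\<close> are one more than the states
    available, so some state recurs.\<close>
  have "(\<lambda>k. (\<delta> ^^ k) 0) ` {..?n} \<subseteq> {..<?n}"
  proof (rule image_subsetI)
    fix k show "(\<delta> ^^ k) 0 \<in> {..<?n}" by (induction k) (use n \<delta> in auto)
  qed
  then have "\<not> inj_on (\<lambda>k. (\<delta> ^^ k) 0) {..?n}"
    using card_inj_on_le[of "\<lambda>k. (\<delta> ^^ k) 0" "{..?n}" "{..<?n}"] by auto
  then obtain k l where "k < l" and eq: "(\<delta> ^^ k) 0 = (\<delta> ^^ l) 0"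
    unfolding inj_on_def by (metis linorder_neqE_nat)
  define p where "p = l - k"
  have p: "0 < p" "l = k + p" using \<open>k < l\<close> by (auto simp: p_def)
  have 1: "u (k + p) 0 = u k 0 * u p ((\<delta> ^^ k) 0)"
    using uadd[OF n] .
  \<comment> \<open>After \<open>k + p\<close> letters the path is back in its state at time
    \<open>k\<close>, hence the same factor as in \<open>1\<close>.\<close>
  have 2: "u (k + 2 * p) 0 = u (k + p) 0 * u p ((\<delta> ^^ k) 0)"
    using uadd[OF n, of "k + p" p] eq p(2) by (simp add: mult_2 add.assoc)
  have "u k 0 * u (k + 2 * p) 0 = (u (k + p) 0)\<^sup>2"
    using 1 2 by (simp add: power2_eq_square)
  then show ?thesis
    using that[OF p(1)] by (simp add: u_def word_prob_eq_state_prob[OF M lists])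
qed

section \<open>A two-state generator with a Jordan block\<close>

text \<open>Symbol 0 acts by a block with eigenvalue 1/2 and off-diagonal entry 1/4, whose row sums
  are 3/4 and 1/2. Symbol 1 carries the missing mass 1/4 and 1/2 back to state 0. No row of either
  matrix vanishes, so every word gets positive probability.\<close>

definition jordan_generator :: "nat machine" where
  "jordan_generator = \<lparr>num_states = 2, alphabet = {0, 1},
     trans = (\<lambda>y. if y = 0
       then mat 2 2 (\<lambda>(i, j). if i = j then 1/2 else if i = 0 then 1/4 else 0)
       else mat 2 2 (\<lambda>(i, j). if j = 1 then 0 else if i = 0 then 1/4 else 1/2))\<rparr>"

lemma jordan_generator_simps [simp]:
  "num_states jordan_generator = 2"
  "alphabet jordan_generator = {0, 1}"
  by (simp_all add: jordan_generator_def)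

lemma stochastic_jordan_generator: "stochastic_machine jordan_generator"
  by (auto simp: stochastic_machine_def row_stochastic_def total_mat_def jordan_generator_def
      numeral_2_eq_2 less_Suc_eq)

lemma state_prob_jordan_generator:
  assumes "w \<in> lists {0, 1}"
  shows "state_prob jordan_generator (0 # w) 0 =
      state_prob jordan_generator w 0 / 2 + state_prob jordan_generator w 1 / 4"
    and "state_prob jordan_generator (0 # w) 1 = state_prob jordan_generator w 1 / 2"
    and "state_prob jordan_generator (1 # w) 0 = state_prob jordan_generator w 0 / 4"
    and "state_prob jordan_generator (1 # w) 1 = state_prob jordan_generator w 0 / 2"
  using assms
  by (simp_all add: state_prob_Cons[OF stochastic_jordan_generator] lessThan_Suc numeral_2_eq_2)
     (simp_all add: jordan_generator_def)

lemma state_prob_jordan_generator_pos: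
  "w \<in> lists {0, 1} \<Longrightarrow>
    0 < state_prob jordan_generator w 0 \<and> 0 < state_prob jordan_generator w 1"
proof (induction w)
  case Nil
  then show ?case by (simp add: state_prob_Nil)
next
  case (Cons y w)
  then have "w \<in> lists {0, 1}" "y = 0 \<or> y = 1" by auto
  then show ?case using Cons state_prob_jordan_generator[of w] by auto
qed

lemma word_prob_jordan_generator_pos:
  "w \<in> lists {0, 1} \<Longrightarrow> 0 < word_prob jordan_generator w"
  using state_prob_jordan_generator_pos
  by (simp add: word_prob_eq_state_prob[OF stochastic_jordan_generator])

lemma word_prob_jordan_generator_replicate:
  "word_prob jordan_generator (replicate m 0) = (real m + 2) / 2 ^ Suc m"
proof -
  have lists: "replicate m (0::nat) \<in> lists {0, 1}" for m by auto
  \<comment> \<open>State 1 feeds the recursion for state 0, so both values are tracked. After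
    scaling by \<open>2^m\<close>, the value from state 0 grows by 1/2 per letter, which gives the
    affine factor.\<close>
  have "state_prob jordan_generator (replicate m 0) 0 = (real m + 2) / 2 ^ Suc m \<and>
      state_prob jordan_generator (replicate m 0) 1 = 1 / 2 ^ m"
  proof (induction m)
    case 0
    then show ?case by (simp add: state_prob_Nil)
  next
    case (Suc m)
    have "state_prob jordan_generator (0 # replicate m 0) 0 =
        (real m + 2) / 2 ^ Suc m / 2 + 1 / 2 ^ m / 4"
      and "state_prob jordan_generator (0 # replicate m 0) 1 = 1 / 2 ^ m / 2"
      unfolding state_prob_jordan_generator[OF lists]
        conjunct1[OF Suc.IH] conjunct2[OF Suc.IH] by (rule refl)+
    moreover have "(real m + 2) / 2 ^ Suc m / 2 + 1 / 2 ^ m / 4 = (real (Suc m) + 2) / 2 ^ Suc (Suc m)"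
      by (simp add: field_simps)
    ultimately show ?case by simp
  qed
  then show ?thesis
    using lists by (simp add: word_prob_eq_state_prob[OF stochastic_jordan_generator])
qed

theorem proposition4:
  "\<exists>G :: nat machine.
     SG G \<and>
     process_language (alphabet G) (word_prob G) \<and>
     \<not> (\<exists>R. SDR R \<and> recognizes R (alphabet G) (word_prob G))"
proof (intro exI[of _ jordan_generator] conjI notI)
  show "SG jordan_generator"
    using stochastic_jordan_generator by (simp add: SG_def)
  show "process_language (alphabet jordan_generator) (word_prob jordan_generator)"
    by (rule process_language_word_prob[OF stochastic_jordan_generator])
       (simp add: word_prob_jordan_generator_pos)
  assume "\<exists>R. SDR R \<and> recognizes R (alphabet jordan_generator) (word_prob jordan_generator)"
  then obtain R :: "nat machine" where R: "SDR R" and alph: "alphabet R = {0, 1}"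
    and word: "\<And>w. w \<in> lists {0, 1} \<Longrightarrow> word_prob R w = word_prob jordan_generator w"
    by (auto simp: recognizes_def)
  have prob: "word_prob R (replicate m 0) = (real m + 2) / 2 ^ Suc m" for m
  proof -
    have "replicate m (0::nat) \<in> lists {0, 1}" by auto
    from word[OF this] show ?thesis by (simp only: word_prob_jordan_generator_replicate)
  qed
  have "0 \<in> alphabet R" using alph by simp
  then obtain k p where p: "0 < p" and
    geo: "word_prob R (replicate k 0) * word_prob R (replicate (k + 2 * p) 0) =
      (word_prob R (replicate (k + p) 0))\<^sup>2"
    using SDR_geometric_progression[OF R] by blast
  \<comment> \<open>The exponents form an arithmetic progression, so the powers of two cancel from
    \<open>geo\<close> and only the affine factors remain.\<close>
  have "(2 ^ Suc k * 2 ^ Suc (k + 2 * p) :: real) = (2 ^ Suc (k + p))\<^sup>2"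
    by (simp add: power2_eq_square flip: power_add)
  with geo have "(real k + 2) * (real k + 2 * real p + 2) = (real k + real p + 2)\<^sup>2"
    unfolding prob times_divide_times_eq power_divide by simp
  \<comment> \<open>With \<open>x = k + p + 2\<close> the equation reads
    \<open>(x - p) * (x + p) = x^2\<close>.\<close>
  then have "(real p)\<^sup>2 = 0" by (simp add: power2_eq_square algebra_simps)
  with p show False by simp
qed

end
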